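(* For each even $n\ge 8$, let $G_1=G_1(n)$ be the tree $C_{n,k}$ with $k=\frac n2-1$ and let $G_2=G_2(n)$ be the tree $C_{n,k}$ with $k=2$, where $C_{n,k}$ is the binary tree with $n$ boundary vertices defined in the context. Let $Q_1=Q(G_1)$ and $Q_2=Q(G_2)$ be the associated matrices. Then $$\det Q_1=\frac{4^{n-3}\,n^2}{2(n-1)^{2n}(n-2)\,\bigl((n-2)!\bigr)^2},\qquad \det Q_2=\frac{6\cdot 4^{n-3}}{(n-1)^{2n}(n-2)^2\,(n-4)!\,(n-2)!},$$ and hence $$\frac{\det Q_1}{\det Q_2}=\frac1{12}\,\frac{n^2}{n-3},\qquad \lim_{n\to\infty}\frac{\det Q_1}{\det Q_2}=\infty .$$
   Context: A binary tree is a finite tree in which every vertex has degree $1$ or $3$; its boundary vertices are its vertices of degree $1$. A binary tree with $n$ boundary vertices has $m=2n-3$ edges. For a binary tree $G$ with edges enumerated by $1,\dots,m$, let $q_i$ be the number of unordered pairs of distinct boundary vertices whose connecting path contains edge $i$. The $m\times m$ matrix $Q(G)=(Q_{ij})$ is defined by: $Q_{ij}$ is the number of unordered pairs of distinct boundary vertices whose connecting path contains both edges $i$ and $j$, divided by $q_iq_j$. Its determinant does not depend on the enumeration. The tree $C_{n,k}$, for $2\le k\le n-4$: take a path with consecutive vertices $v_0,v_1,\dots,v_{n-2}$ (so its edges are $e_t=v_{t-1}v_t$, $t=1,\dots,n-2$). For each $t\in\{1,\dots,n-3\}$ with $t\ne k$ attach to $v_t$ one new edge ending in a new vertex of degree $1$;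 to $v_k$ (the vertex between the $k$-th and $(k+1)$-th edges of the path) attach one new edge $v_ku$ and attach to $u$ two further new edges, each ending in a new vertex of degree $1$. The resulting tree is binary with $n$ boundary vertices. Deleting $v_k$ splits its boundary vertices into groups of sizes $k$, $2$ and $n-2-k$. *)

theory Defs
  imports
    Complex_Main
    "Graph_Theory.Graph_Theory"
    "Jordan_Normal_Form.Determinant"
begin

section \<open>Binary trees\<close>

text \<open>
  A finite simple graph is a symmetric loop-free digraph (\<^locale>\<open>pair_graph\<close>); its undirected
  edges are the two-element sets underlying the arcs, and the degree of a vertex is its out-degree.
  In this representation every edge yields a directed cycle of length 2, so the undirected cycles
  are the directed cycles of length at least 3.  For this reason the library predicate
  \<^const>\<open>tree\<close> (no directed cycle whatsoever) does not describe undirected trees.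
\<close>

definition edges :: "'a pair_pre_digraph \<Rightarrow> 'a set set" where
  "edges G = (\<lambda>(u, v). {u, v}) ` parcs G"

definition undirected_tree :: "'a pair_pre_digraph \<Rightarrow> bool" where
  "undirected_tree G \<longleftrightarrow>
     pair_graph G \<and> Digraph_Component.connected (with_proj G) \<and>
     (\<nexists>p. pre_digraph.cycle (with_proj G) p \<and> 3 \<le> length p)"

definition binary_tree :: "'a pair_pre_digraph \<Rightarrow> bool" where
  "binary_tree G \<longleftrightarrow>
     undirected_tree G \<and> (\<forall>v\<in>pverts G. out_degree (with_proj G) v \<in> {1, 3})"

definition boundary :: "'a pair_pre_digraph \<Rightarrow> 'a set" where
  "boundary G = {v \<in> pverts G. out_degree (with_proj G) v = 1}"

section \<open>The matrix of a binary tree\<close>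

definition connecting_path :: "'a pair_pre_digraph \<Rightarrow> 'a \<Rightarrow> 'a \<Rightarrow> 'a vwalk" where
  "connecting_path G a b = (THE p. vpath p (with_proj G) \<and> hd p = a \<and> last p = b)"

definition path_edges :: "'a vwalk \<Rightarrow> 'a set set" where
  "path_edges p = (\<lambda>(u, v). {u, v}) ` set (vwalk_arcs p)"

definition pair_count :: "'a pair_pre_digraph \<Rightarrow> 'a set set \<Rightarrow> nat" where
  "pair_count G S =
     card {{a, b} | a b. a \<in> boundary G \<and> b \<in> boundary G \<and> a \<noteq> b \<and>
                         S \<subseteq> path_edges (connecting_path G a b)}"

text \<open>Enumerations of the edges start at 0, in accordance with the indices of \<^typ>\<open>real mat\<close>.\<close>

definition edge_enum :: "'a pair_pre_digraph \<Rightarrow> (nat \<Rightarrow> 'a set) \<Rightarrow> bool" where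
  "edge_enum G e \<longleftrightarrow> bij_betw e {..<card (edges G)} (edges G)"

definition Q_mat :: "'a pair_pre_digraph \<Rightarrow> (nat \<Rightarrow> 'a set) \<Rightarrow> real mat" where
  "Q_mat G e =
     mat (card (edges G)) (card (edges G))
       (\<lambda>(i, j). real (pair_count G {e i, e j}) /
                 (real (pair_count G {e i}) * real (pair_count G {e j})))"

section \<open>The trees $C_{n,k}$\<close>

text \<open>
  \<open>Spine t\<close> is $v_t$, \<open>Leaf t\<close> is the new vertex attached to $v_t$, and \<open>Hub\<close> is $u$.
  The values of \<open>C_tree n k\<close> are meaningful for $2 \le k \le n - 4$ only.
\<close>

datatype cvertex = Spine nat | Leaf nat | Hub | HubLeaf1 | HubLeaf2

definition C_arcs :: "nat \<Rightarrow> nat \<Rightarrow> cvertex rel" where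
  "C_arcs n k =
     {(Spine (t - 1), Spine t) | t. t \<in> {1..n - 2}} \<union>
     {(Spine t, Leaf t) | t. t \<in> {1..n - 3} - {k}} \<union>
     {(Spine k, Hub), (Hub, HubLeaf1), (Hub, HubLeaf2)}"

definition C_tree :: "nat \<Rightarrow> nat \<Rightarrow> cvertex pair_pre_digraph" where
  "C_tree n k =
     \<lparr> pverts = Spine ` {0..n - 2} \<union> Leaf ` ({1..n - 3} - {k}) \<union> {Hub, HubLeaf1, HubLeaf2},
       parcs = C_arcs n k \<union> (C_arcs n k)\<inverse> \<rparr>"

lemma pair_graph_C_tree:
  assumes "2 \<le> k" "k \<le> n - 4"
  shows "pair_graph (C_tree n k)"
proof
  have fin: "finite (C_arcs n k)"
    unfolding C_arcs_def by (auto simp: setcompr_eq_image)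
  show "finite (pverts (C_tree n k))" "finite (parcs (C_tree n k))"
    using fin by (simp_all add: C_tree_def)
  show "symmetric (with_proj (C_tree n k))"
    by (auto simp: symmetric_def C_tree_def sym_def)
next
  fix e assume "e \<in> parcs (C_tree n k)"
  then show "fst e \<in> pverts (C_tree n k)" "snd e \<in> pverts (C_tree n k)" "fst e \<noteq> snd e"
    using assms by (auto simp: C_tree_def C_arcs_def)
qed

lemma connected_C_tree:
  assumes "2 \<le> k" "k \<le> n - 4"
  shows "Digraph_Component.connected (with_proj (C_tree n k))"
proof -
  let ?G = "with_proj (C_tree n k)"
  interpret pair_graph "C_tree n k" by (rule pair_graph_C_tree[OF assms])
  have arc: "(a, b) \<in> parcs (C_tree n k)" if "(a, b) \<in> C_arcs n k" for a b
    using that by (simp add: C_tree_def)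
  have spine: "Spine 0 \<rightarrow>\<^sup>*\<^bsub>?G\<^esub> Spine t" if "t \<le> n - 2" for t
    using that
  proof (induction t)
    case 0
    show ?case by (rule reachable_refl) (simp add: C_tree_def)
  next
    case (Suc t)
    have "(Spine t, Spine (Suc t)) \<in> parcs (C_tree n k)"
      using Suc.prems by (intro arc) (force simp: C_arcs_def)
    then show ?case using Suc.prems by (intro reachable_adj_trans[OF Suc.IH]) auto
  qed
  have hub: "Spine 0 \<rightarrow>\<^sup>*\<^bsub>?G\<^esub> Hub"
    using assms by (intro reachable_adj_trans[OF spine[of k]] arc) (auto simp: C_arcs_def)
  have root: "Spine 0 \<rightarrow>\<^sup>*\<^bsub>?G\<^esub> v" if v: "v \<in> pverts (C_tree n k)" for v
  proof (cases v)
    case (Spine t)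
    with v have "t \<le> n - 2" by (auto simp: C_tree_def)
    with Spine show ?thesis by (simp add: spine)
  next
    case (Leaf t)
    with v show ?thesis
      by (intro reachable_adj_trans[OF spine[of t]] arc) (auto simp: C_tree_def C_arcs_def)
  next
    case Hub
    with hub show ?thesis by simp
  next
    case HubLeaf1
    then show ?thesis
      by (intro reachable_adj_trans[OF hub] arc) (auto simp: C_arcs_def)
  next
    case HubLeaf2
    then show ?thesis
      by (intro reachable_adj_trans[OF hub] arc) (auto simp: C_arcs_def)
  qed
  have "u \<rightarrow>\<^sup>*\<^bsub>with_proj (mk_symmetric ?G)\<^esub> v"
    if "u \<in> pverts (C_tree n k)" "v \<in> pverts (C_tree n k)" for u v
    using that root reachable_trans symmetric_reachable'
    by (intro reachable_mk_symmetricI) blast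
  then show ?thesis
    by (auto simp: Digraph_Component.connected_def strongly_connected_def C_tree_def)
qed

text \<open>
  In a directed cycle of length at least 3 the predecessor and the successor of a vertex of maximal
  height differ, but such a vertex has only one neighbour of smaller height.
\<close>

definition C_height :: "nat \<Rightarrow> cvertex \<Rightarrow> nat" where
  "C_height k v =
     (case v of Spine t \<Rightarrow> 3 * t | Leaf t \<Rightarrow> 3 * t + 1 | Hub \<Rightarrow> 3 * k + 1 | _ \<Rightarrow> 3 * k + 2)"

lemma C_arcs_height: "(a, b) \<in> C_arcs n k \<Longrightarrow> C_height k a < C_height k b"
  by (auto simp: C_arcs_def C_height_def)

lemma C_arcs_parent_unique: "(a, c) \<in> C_arcs n k \<Longrightarrow> (b, c) \<in> C_arcs n k \<Longrightarrow> a = b"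
  by (auto simp: C_arcs_def)

lemma pcas_nth: "pcas u p v \<Longrightarrow> Suc i < length p \<Longrightarrow> snd (p ! i) = fst (p ! Suc i)"
proof (induction p arbitrary: u i)
  case (Cons e p)
  then show ?case by (cases i; cases p) auto
qed simp

lemma pcas_ends: "pcas u p v \<Longrightarrow> p \<noteq> [] \<Longrightarrow> fst (p ! 0) = u \<and> snd (p ! (length p - 1)) = v"
proof (induction p arbitrary: u)
  case (Cons e p)
  then show ?case by (cases p) auto
qed simp

lemma acyclic_C_tree:
  assumes "2 \<le> k" "k \<le> n - 4"
  shows "\<nexists>p. pre_digraph.cycle (with_proj (C_tree n k)) p \<and> 3 \<le> length p"
proof
  let ?G = "with_proj (C_tree n k)"
  interpret pair_graph "C_tree n k" by (rule pair_graph_C_tree[OF assms])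
  assume "\<exists>p. cycle p \<and> 3 \<le> length p"
  then obtain p u where len: "3 \<le> length p" and aw: "awalk u p u"
    and dist: "distinct (tl (pawalk_verts u p))"
    unfolding cycle_def by blast
  from aw have cas: "pcas u p u" and arcs: "set p \<subseteq> parcs (C_tree n k)"
    unfolding awalk_def by auto
  have "pcas u p v \<Longrightarrow> pawalk_verts u p = u # map snd p" for u v p
    by (induction p arbitrary: u) auto
  with cas dist have dist: "distinct (map snd p)" by (metis list.sel(3))
  define h where "h i = C_height k (snd (p ! i))" for i
  define i where "i = (ARG_MAX h i. i < length p)"
  have i_max: "i < length p \<and> (\<forall>j. j < length p \<longrightarrow> h j \<le> h i)"
    unfolding i_def using len
    by (intro arg_max_nat_lemma[where b = "Suc (Max (h ` {..<length p}))" and k = 0])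
       (auto simp: less_Suc_eq_le)
  then have i: "i < length p" by simp
  define s where "s = (if Suc i = length p then 0 else Suc i)"
  define r where "r = (if i = 0 then length p - 1 else i - 1)"
  have s: "s < length p" "fst (p ! s) = snd (p ! i)"
    using i len pcas_nth[OF cas, of i] pcas_ends[OF cas]
    by (cases "Suc i = length p"; auto simp: s_def; cases p; auto)+
  have r: "r < length p" "snd (p ! r) = fst (p ! i)"
    using i len pcas_nth[OF cas, of "i - 1"] pcas_ends[OF cas] by (auto simp: r_def)
  have "r \<noteq> s" using i len by (auto simp: r_def s_def)
  have "(fst (p ! i), snd (p ! i)) \<in> parcs (C_tree n k)"
    "(fst (p ! s), snd (p ! s)) \<in> parcs (C_tree n k)"
    using arcs i s(1) by auto
  then have "(snd (p ! r), snd (p ! i)) \<in> C_arcs n k \<union> (C_arcs n k)\<inverse>"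
    "(snd (p ! i), snd (p ! s)) \<in> C_arcs n k \<union> (C_arcs n k)\<inverse>"
    unfolding r(2) s(2) by (simp_all add: C_tree_def)
  moreover have "h r \<le> h i" "h s \<le> h i" using i_max r s by auto
  ultimately have "(snd (p ! r), snd (p ! i)) \<in> C_arcs n k" "(snd (p ! s), snd (p ! i)) \<in> C_arcs n k"
    by (auto simp: h_def dest: C_arcs_height)
  then have "snd (p ! r) = snd (p ! s)" by (rule C_arcs_parent_unique)
  with r(1) s(1) \<open>r \<noteq> s\<close> show False
    using nth_eq_iff_index_eq[OF dist, of r s] by simp
qed

lemma C_arcs_iff:
  "(Spine t, w) \<in> C_arcs n k \<longleftrightarrow>
     w = Spine (Suc t) \<and> Suc t \<le> n - 2 \<or> w = Leaf t \<and> t \<in> {1..n - 3} - {k} \<or> w = Hub \<and> t = k"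
  "(Leaf t, w) \<notin> C_arcs n k"
  "(Hub, w) \<in> C_arcs n k \<longleftrightarrow> w = HubLeaf1 \<or> w = HubLeaf2"
  "(HubLeaf1, w) \<notin> C_arcs n k"
  "(HubLeaf2, w) \<notin> C_arcs n k"
  "(w, Spine t) \<in> C_arcs n k \<longleftrightarrow> t \<in> {1..n - 2} \<and> w = Spine (t - 1)"
  "(w, Leaf t) \<in> C_arcs n k \<longleftrightarrow> t \<in> {1..n - 3} - {k} \<and> w = Spine t"
  "(w, Hub) \<in> C_arcs n k \<longleftrightarrow> w = Spine k"
  "(w, HubLeaf1) \<in> C_arcs n k \<longleftrightarrow> w = Hub"
  "(w, HubLeaf2) \<in> C_arcs n k \<longleftrightarrow> w = Hub"
  by (force simp: C_arcs_def)+

lemma pverts_C_tree: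
  "Spine t \<in> pverts (C_tree n k) \<longleftrightarrow> t \<le> n - 2"
  "Leaf t \<in> pverts (C_tree n k) \<longleftrightarrow> t \<in> {1..n - 3} - {k}"
  "Hub \<in> pverts (C_tree n k)" "HubLeaf1 \<in> pverts (C_tree n k)" "HubLeaf2 \<in> pverts (C_tree n k)"
  by (auto simp: C_tree_def)

lemma out_arcs_conv_C_tree:
  "out_arcs (with_proj (C_tree n k)) v =
     Pair v ` ({w. (v, w) \<in> C_arcs n k} \<union> {w. (w, v) \<in> C_arcs n k})"
  by (auto simp: out_arcs_def C_tree_def)

lemma out_arcs_C_tree:
  assumes "2 \<le> k" "k \<le> n - 4"
  defines "G \<equiv> with_proj (C_tree n k)"
  shows
    "out_arcs G (Spine 0) = Pair (Spine 0) ` {Spine 1}"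
    "out_arcs G (Spine (n - 2)) = Pair (Spine (n - 2)) ` {Spine (n - 3)}"
    "t \<in> {1..n - 3} - {k} \<Longrightarrow>
       out_arcs G (Spine t) = Pair (Spine t) ` {Spine (t - 1), Spine (t + 1), Leaf t}"
    "out_arcs G (Spine k) = Pair (Spine k) ` {Spine (k - 1), Spine (k + 1), Hub}"
    "t \<in> {1..n - 3} - {k} \<Longrightarrow> out_arcs G (Leaf t) = Pair (Leaf t) ` {Spine t}"
    "out_arcs G Hub = Pair Hub ` {Spine k, HubLeaf1, HubLeaf2}"
    "out_arcs G HubLeaf1 = Pair HubLeaf1 ` {Hub}"
    "out_arcs G HubLeaf2 = Pair HubLeaf2 ` {Hub}"
  unfolding G_def out_arcs_conv_C_tree using assms(1,2)
  by (intro arg_cong2[of _ _ _ _ image] refl; auto simp: C_arcs_iff)+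

lemma out_degree_C_tree:
  assumes "2 \<le> k" "k \<le> n - 4" "v \<in> pverts (C_tree n k)"
  shows "out_degree (with_proj (C_tree n k)) v =
    (case v of Spine t \<Rightarrow> if t = 0 \<or> t = n - 2 then 1 else 3 | Hub \<Rightarrow> 3 | _ \<Rightarrow> 1)"
proof (cases v)
  case (Spine t)
  have "t \<le> n - 2" using assms(3) Spine by (auto simp: C_tree_def)
  then consider "t = 0" | "t = n - 2" | "t = k" | "t \<in> {1..n - 3} - {k}" by force
  then show ?thesis
    by cases (use assms(1,2) Spine in \<open>auto simp: out_degree_def out_arcs_C_tree\<close>)
next
  case (Leaf t)
  then have "t \<in> {1..n - 3} - {k}" using assms(3) by (auto simp: C_tree_def)
  then show ?thesis using assms(1,2) Leaf by (simp add: out_degree_def out_arcs_C_tree)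
qed (use assms(1,2) in \<open>simp_all add: out_degree_def out_arcs_C_tree\<close>)

lemma binary_tree_C_tree:
  assumes "2 \<le> k" "k \<le> n - 4"
  shows "binary_tree (C_tree n k)"
  using pair_graph_C_tree[OF assms] connected_C_tree[OF assms] acyclic_C_tree[OF assms]
  by (auto simp: binary_tree_def undirected_tree_def out_degree_C_tree[OF assms]
      split: cvertex.splits)

lemma boundary_C_tree:
  assumes "2 \<le> k" "k \<le> n - 4"
  shows "boundary (C_tree n k) =
    {Spine 0, Spine (n - 2), HubLeaf1, HubLeaf2} \<union> Leaf ` ({1..n - 3} - {k})"
proof (rule Set.set_eqI)
  fix v
  show "v \<in> boundary (C_tree n k) \<longleftrightarrow>
      v \<in> {Spine 0, Spine (n - 2), HubLeaf1, HubLeaf2} \<union> Leaf ` ({1..n - 3} - {k})"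
  proof (cases "v \<in> pverts (C_tree n k)")
    case True
    then show ?thesis
      by (cases v) (simp_all add: boundary_def out_degree_C_tree[OF assms] pverts_C_tree image_iff)
  next
    case False
    then show ?thesis
      by (cases v) (auto simp: boundary_def pverts_C_tree)
  qed
qed

lemma card_boundary_C_tree:
  assumes "2 \<le> k" "k \<le> n - 4"
  shows "card (boundary (C_tree n k)) = n"
proof -
  have "card (Leaf ` ({1..n - 3} - {k})) = n - 4"
    using assms by (subst card_image) (auto simp: inj_on_def)
  moreover have "{Spine 0, Spine (n - 2), HubLeaf1, HubLeaf2} \<inter> Leaf ` ({1..n - 3} - {k}) = {}"
    by auto
  ultimately show ?thesis
    using assms by (simp add: boundary_C_tree[OF assms] card_Un_disjoint)
qed

definition G1 :: "nat \<Rightarrow> cvertex pair_pre_digraph" where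
  "G1 n = C_tree n (n div 2 - 1)"

definition G2 :: "nat \<Rightarrow> cvertex pair_pre_digraph" where
  "G2 n = C_tree n 2"

end

theory Submission
  imports Defs
begin

text \<open>
  Orient a binary tree away from a boundary vertex, the root. Edges then correspond to the non-root
  vertices $v$ (the edge above $v$). Let $s_v$ be the number of boundary vertices below that edge
  and $n$ the number of all boundary vertices. The path between two boundary vertices uses
  the edge above $v$ exactly if one end lies below $v$ and the other does not
  (\<open>edge_above_in_path_iff\<close>). Counting such pairs gives, after multiplication of row and column
  $v$ by $n - s_v$, the entry $1$ for two edges neither of which is below the other, and
  $(n - s_v)/s_v$ for two edges the upper one of which is above $v$ (\<open>Q_entry\<close>).

  So $Q$ is, up to a diagonal scaling, $N + J$ with $J$ the all-ones matrix and $N_{uv}$ the weight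
  $w = (n - 2s)/s$ of the upper one of the two edges, or $0$ if they are incomparable. For such a
  matrix, take $1/w_p$ times the column of $p$ and subtract $1/w_c$ times the column of $c$ for every
  child $c$ of $p$: below $p$ all entries cancel, so these column operations make $N$ triangular.
  The matrix $J$ is removed by subtracting multiples of the row of the top edge, which is constant.
  This yields the determinant as a product over the vertices (\<open>det_tree_kernel\<close>). A weight vanishes
  if an edge halves the boundary, which does happen; since both sides of the formula are polynomials
  in the weights, this case follows by a perturbation.

  With $w = (n - 2s)/s$ the factor of a vertex with two children collapses to $4(n - s)/s$, whence
  \<open>det_Q_mat\<close>: $\det Q = (n-1)^{1-2n} \prod 4/(s_v(n - s_v))$ over the internal vertices $v$.
  For $C_{n,k}$ rooted at $v_0$ the numbers $s_v$ along the spine run through $2, \dots, n-1$ with the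
  single value $n-1-k$ left out, so the product is a quotient of factorials (\<open>det_Q_C_tree\<close>), and the
  two trees of the theorem are the cases $k = n/2 - 1$ and $k = 2$.
\<close>

section \<open>Determinants indexed by a finite set\<close>

text \<open>
  A matrix over a finite index set, carried to the indices of \<^typ>\<open>real mat\<close> by an arbitrary
  enumeration; no order on the index set has to be chosen.
\<close>

definition enum_mat :: "nat \<Rightarrow> (nat \<Rightarrow> 'a) \<Rightarrow> ('a \<Rightarrow> 'a \<Rightarrow> real) \<Rightarrow> real mat" where
  "enum_mat m x f = mat m m (\<lambda>(i, j). f (x i) (x j))"

lemma enum_mat_carrier [simp]: "enum_mat m x f \<in> carrier_mat m m"
  by (simp add: enum_mat_def)

lemma enum_mat_cong:
  assumes "bij_betw x {..<m} V" "\<And>u v. u \<in> V \<Longrightarrow> v \<in> V \<Longrightarrow> f u v = g u v"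
  shows "enum_mat m x f = enum_mat m x g"
  unfolding enum_mat_def using bij_betwE[OF assms(1)] by (intro cong_mat) (auto intro: assms(2))

lemma enum_mat_mult:
  assumes "bij_betw x {..<m} V"
  shows "enum_mat m x f * enum_mat m x g = enum_mat m x (\<lambda>u v. \<Sum>k\<in>V. f u k * g k v)"
proof (rule eq_matI)
  fix i j assume "i < dim_row (enum_mat m x (\<lambda>u v. \<Sum>k\<in>V. f u k * g k v))"
    "j < dim_col (enum_mat m x (\<lambda>u v. \<Sum>k\<in>V. f u k * g k v))"
  then have ij: "i < m" "j < m" by (auto simp: enum_mat_def)
  have "(enum_mat m x f * enum_mat m x g) $$ (i, j) = (\<Sum>l<m. f (x i) (x l) * g (x l) (x j))"
    using ij by (simp add: enum_mat_def scalar_prod_def atLeast0LessThan)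
  also have "\<dots> = (\<Sum>k\<in>V. f (x i) k * g k (x j))"
    by (rule sum.reindex_bij_betw[OF assms])
  finally show "(enum_mat m x f * enum_mat m x g) $$ (i, j) =
      enum_mat m x (\<lambda>u v. \<Sum>k\<in>V. f u k * g k v) $$ (i, j)"
    using ij by (simp add: enum_mat_def)
qed (auto simp: enum_mat_def)

lemma det_enum_mat:
  "det (enum_mat m x f) =
     (\<Sum>p | p permutes {..<m}. signof p * (\<Prod>i<m. f (x i) (x (p i))))"
proof -
  have "(\<Prod>i<m. enum_mat m x f $$ (i, p i)) = (\<Prod>i<m. f (x i) (x (p i)))"
    if "p permutes {..<m}" for p
  proof (rule prod.cong)
    fix i assume "i \<in> {..<m}"
    moreover from this have "p i < m" using permutes_in_image[OF that, of i] by simp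
    ultimately show "enum_mat m x f $$ (i, p i) = f (x i) (x (p i))"
      by (simp add: enum_mat_def)
  qed simp
  then show ?thesis
    by (simp add: det_def'[OF enum_mat_carrier] atLeast0LessThan)
qed

text \<open>
  Triangularity with respect to a rank function instead of an enumeration: a permutation with a
  nonzero product never lowers the rank, but it preserves the sum of all ranks, so it is the identity.
\<close>

lemma det_enum_mat_triangular:
  fixes r :: "'a \<Rightarrow> int"
  assumes x: "bij_betw x {..<m} V"
    and tri: "\<And>u v. u \<in> V \<Longrightarrow> v \<in> V \<Longrightarrow> f u v \<noteq> 0 \<Longrightarrow> u = v \<or> r u < r v"
  shows "det (enum_mat m x f) = (\<Prod>v\<in>V. f v v)"
proof -
  have V: "x i \<in> V" if "i < m" for i
    using x that by (auto simp: bij_betw_def)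
  have zero: "(\<Prod>i<m. f (x i) (x (p i))) = 0" if p: "p permutes {..<m}" and "p \<noteq> id" for p
  proof (rule ccontr)
    assume nz: "(\<Prod>i<m. f (x i) (x (p i))) \<noteq> 0"
    have pm: "p i < m" if "i < m" for i
      using permutes_in_image[OF p, of i] that by simp
    have step: "x i = x (p i) \<or> r (x i) < r (x (p i))" if "i < m" for i
      using that nz by (intro tri V pm) auto
    obtain i where i: "i < m" "p i \<noteq> i"
      using \<open>p \<noteq> id\<close> p by (metis eq_id_iff lessThan_iff permutes_not_in)
    have "x i \<noteq> x (p i)"
      using x i pm[OF i(1)] by (auto simp: bij_betw_def inj_on_def)
    with step[OF i(1)] have less: "r (x i) < r (x (p i))" by simp
    have "(\<Sum>i<m. r (x i)) < (\<Sum>i<m. r (x (p i)))"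
    proof (rule sum_strict_mono_ex1)
      show "\<forall>i\<in>{..<m}. r (x i) \<le> r (x (p i))"
        using step by (metis lessThan_iff order.order_iff_strict)
    qed (use less i(1) in auto)
    also have "\<dots> = (\<Sum>i<m. r (x i))"
      using sum.permute[OF p, of "\<lambda>i. r (x i)"] by (simp add: o_def)
    finally show False by simp
  qed
  have "det (enum_mat m x f) =
      (\<Sum>p | p permutes {..<m}. signof p * (\<Prod>i<m. f (x i) (x (p i))))"
    unfolding det_enum_mat ..
  also have "\<dots> = (\<Sum>p\<in>{id}. signof p * (\<Prod>i<m. f (x i) (x (p i))))"
    by (rule sum.mono_neutral_right) (auto simp: zero finite_permutations permutes_id)
  also have "\<dots> = (\<Prod>i<m. f (x i) (x i))"
    by simp
  also have "\<dots> = (\<Prod>v\<in>V. f v v)"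
    by (rule prod.reindex_bij_betw[OF x])
  finally show ?thesis .
qed

lemma det_enum_mat_scale:
  assumes x: "bij_betw x {..<m} V"
  shows "det (enum_mat m x (\<lambda>u v. c u * c v * f u v)) = (\<Prod>v\<in>V. c v)\<^sup>2 * det (enum_mat m x f)"
proof -
  have "(\<Prod>i<m. c (x i) * c (x (p i)) * f (x i) (x (p i))) =
      (\<Prod>v\<in>V. c v)\<^sup>2 * (\<Prod>i<m. f (x i) (x (p i)))" if p: "p permutes {..<m}" for p
  proof -
    have "(\<Prod>i<m. c (x (p i))) = (\<Prod>i<m. c (x i))"
      using prod.permute[OF p, of "\<lambda>i. c (x i)"] by (simp add: o_def)
    also have "\<dots> = (\<Prod>v\<in>V. c v)"
      by (rule prod.reindex_bij_betw[OF x])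
    finally show ?thesis
      by (simp add: prod.distrib prod.reindex_bij_betw[OF x] power2_eq_square)
  qed
  then show ?thesis
    by (simp add: det_enum_mat sum_distrib_left mult_ac)
qed

section \<open>Rooted trees\<close>

text \<open>
  The arcs point away from the root; the function \<open>h\<close> serves to exclude cycles and as an
  induction measure.
\<close>

locale rooted_tree =
  fixes A :: "'a rel" and h :: "'a \<Rightarrow> nat" and root :: 'a
  assumes finite_arcs: "finite A"
    and parent_unique: "(a, c) \<in> A \<Longrightarrow> (b, c) \<in> A \<Longrightarrow> a = b"
    and height_less: "(a, b) \<in> A \<Longrightarrow> h a < h b"
    and Domain_subset: "Domain A \<subseteq> insert root (Range A)"
    and root_no_parent: "root \<notin> Range A"
begin

definition children :: "'a \<Rightarrow> 'a set" where
  "children v = A `` {v}"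

definition desc :: "'a \<Rightarrow> 'a set" where
  "desc v = A\<^sup>* `` {v}"

lemma desc_refl [simp]: "v \<in> desc v"
  by (simp add: desc_def)

lemma desc_trans: "x \<in> desc u \<Longrightarrow> u \<in> desc v \<Longrightarrow> x \<in> desc v"
  by (auto simp: desc_def)

lemma child_in_desc: "c \<in> children v \<Longrightarrow> c \<in> desc v"
  by (auto simp: desc_def children_def)

lemma desc_unfold: "desc v = insert v (\<Union>c\<in>children v. desc c)"
proof (intro equalityI subsetI)
  fix u assume "u \<in> desc v"
  then have "(v, u) \<in> A\<^sup>*" by (simp add: desc_def)
  then show "u \<in> insert v (\<Union>c\<in>children v. desc c)"
    by (cases rule: converse_rtranclE) (auto simp: desc_def children_def)
next
  fix u assume "u \<in> insert v (\<Union>c\<in>children v. desc c)"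
  then show "u \<in> desc v"
    by (auto simp: desc_def children_def intro: converse_rtrancl_into_rtrancl)
qed

lemma desc_height: "u \<in> desc v \<Longrightarrow> u = v \<or> h v < h u"
proof -
  have "(v, u) \<in> A\<^sup>* \<Longrightarrow> u = v \<or> h v < h u"
    by (induction rule: rtrancl_induct) (auto dest: height_less)
  then show "u \<in> desc v \<Longrightarrow> u = v \<or> h v < h u" by (simp add: desc_def)
qed

lemma child_height: "c \<in> children v \<Longrightarrow> h v < h c"
  by (auto simp: children_def height_less)

lemma desc_antisym: "u \<in> desc v \<Longrightarrow> v \<in> desc u \<Longrightarrow> u = v"
  using desc_height[of u v] desc_height[of v u] by auto

lemma parent_in_desc:
  assumes "u \<in> desc v" "u \<noteq> v" "(p, u) \<in> A"
  shows "p \<in> desc v"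
proof -
  have "(v, u) \<in> A\<^sup>*" using assms(1) by (simp add: desc_def)
  then show ?thesis
    using assms(2,3) by (cases rule: rtranclE) (auto simp: desc_def dest: parent_unique)
qed

text \<open>
  Among the ancestors of a vertex any two are comparable, as every vertex has at most one parent.
\<close>

lemma desc_laminar:
  assumes "x \<in> desc u" "x \<in> desc v"
  shows "u \<in> desc v \<or> v \<in> desc u"
proof -
  have "(u, x) \<in> A\<^sup>*" using assms by (simp add: desc_def)
  then show ?thesis using assms(2)
  proof (induction rule: rtrancl_induct)
    case (step y z)
    then show ?case
      using parent_in_desc[of z v y]
      by (cases "z = v") (auto simp: desc_def intro: rtrancl_into_rtrancl)
  qed simp
qed

lemma siblings_desc:
  assumes "c \<in> children v" "c' \<in> children v" "c \<in> desc c'"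
  shows "c = c'"
proof (rule ccontr)
  assume "c \<noteq> c'"
  with assms parent_in_desc[of c c' v] have "v \<in> desc c'" by (auto simp: children_def)
  with child_height[OF assms(2)] show False by (auto dest: desc_height)
qed

lemma siblings_desc_disjoint:
  assumes "c \<in> children v" "c' \<in> children v" "c \<noteq> c'"
  shows "desc c \<inter> desc c' = {}"
  using assms desc_laminar siblings_desc by blast

lemma finite_children [simp]: "finite (children v)"
  using finite_arcs by (simp add: children_def finite_Image)

lemma children_subset: "children v \<subseteq> Range A"
  by (auto simp: children_def)

lemma desc_subset_Range: "v \<in> Range A \<Longrightarrow> desc v \<subseteq> Range A"
  by (auto simp: desc_def elim: rtranclE)

lemma finite_Range: "finite (Range A)"
  using finite_arcs by (rule finite_Range)

lemma finite_desc: "v \<in> Range A \<Longrightarrow> finite (desc v)"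
  using finite_subset[OF desc_subset_Range finite_Range] .

lemma mem_desc_root: "v \<in> insert root (Range A) \<Longrightarrow> v \<in> desc root"
proof (induction "h v" arbitrary: v rule: less_induct)
  case less
  show ?case
  proof (cases "v = root")
    case False
    with less.prems obtain p where p: "(p, v) \<in> A" by auto
    then have "p \<in> desc root"
      using Domain_subset height_less by (intro less.hyps) auto
    with p show ?thesis by (auto simp: desc_def)
  qed simp
qed

end

section \<open>The determinant of the kernel of a weighted tree\<close>

context rooted_tree
begin

definition tree_kernel :: "('a \<Rightarrow> real) \<Rightarrow> 'a \<Rightarrow> 'a \<Rightarrow> real" where
  "tree_kernel w u v = (if u \<in> desc v then w v else if v \<in> desc u then w u else 0)"

text \<open>
  The cancellation that makes the matrix triangular. For \<open>u\<close> strictly below \<open>p\<close>, exactly one child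
  of \<open>p\<close> is comparable with \<open>u\<close>, and it contributes \<open>1\<close>, as does \<open>p\<close>; for \<open>u\<close> incomparable with \<open>p\<close>
  all terms are \<open>0\<close>. Hence only ancestors of \<open>p\<close>, and \<open>p\<close> itself, remain.
\<close>

lemma tree_kernel_column:
  assumes w: "\<And>v. v \<in> Range A \<Longrightarrow> w v \<noteq> 0" and p: "p \<in> Range A" and "u \<noteq> p" "\<not> h u < h p"
  shows "tree_kernel w u p / w p - (\<Sum>c\<in>children p. tree_kernel w u c / w c) = 0"
proof (cases "u \<in> desc p")
  case True
  with \<open>u \<noteq> p\<close> obtain c where c: "c \<in> children p" "u \<in> desc c"
    using desc_unfold[of p] by auto
  have "tree_kernel w u d / w d = (if d = c then 1 else 0)" if d: "d \<in> children p" for d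
  proof (cases "d = c")
    case True
    then show ?thesis using c w subsetD[OF children_subset c(1)] by (simp add: tree_kernel_def)
  next
    case False
    then have "desc c \<inter> desc d = {}" using siblings_desc_disjoint c d by blast
    moreover have "d \<notin> desc u" using desc_trans[of d u c] c calculation by auto
    ultimately show ?thesis using False c by (auto simp: tree_kernel_def)
  qed
  then have "(\<Sum>c\<in>children p. tree_kernel w u c / w c) = 1"
    using c by (simp add: sum.delta)
  then show ?thesis using True w p by (simp add: tree_kernel_def)
next
  case False
  with assms have np: "p \<notin> desc u" by (auto dest: desc_height)
  have "tree_kernel w u d = 0" if d: "d \<in> children p" for d
  proof -
    have "u \<notin> desc d" using False desc_trans[of u d p] child_in_desc[OF d] by blast
    moreover have "d \<notin> desc u"
      using desc_laminar[of d u p] child_in_desc[OF d] False np by blast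
    ultimately show ?thesis by (simp add: tree_kernel_def)
  qed
  with False np show ?thesis by (simp add: tree_kernel_def)
qed

lemma tree_kernel_column_diag:
  assumes w: "\<And>v. v \<in> Range A \<Longrightarrow> w v \<noteq> 0"
  shows "(\<Sum>c\<in>children p. tree_kernel w p c / w c) = w p * (\<Sum>c\<in>children p. 1 / w c)"
proof -
  have "tree_kernel w p c = w p" if "c \<in> children p" for c
    using child_in_desc[OF that] child_height[OF that] desc_antisym
    by (force simp: tree_kernel_def)
  then show ?thesis by (simp add: sum_distrib_left)
qed

text \<open>
  The diagonal entry of the triangular matrix, cleared of denominators so that it makes sense for
  weights \<open>0\<close>; for a leaf it is \<open>1\<close>.
\<close>

definition vertex_factor :: "('a \<Rightarrow> real) \<Rightarrow> 'a \<Rightarrow> real" where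
  "vertex_factor w p =
     (\<Prod>c\<in>children p. w c) - w p * (\<Sum>c\<in>children p. \<Prod>d\<in>children p - {c}. w d)"

lemma vertex_factor_nonzero:
  assumes "\<And>v. v \<in> Range A \<Longrightarrow> w v \<noteq> 0"
  shows "vertex_factor w p = (\<Prod>c\<in>children p. w c) * (1 - w p * (\<Sum>c\<in>children p. 1 / w c))"
proof -
  have "(\<Prod>d\<in>children p - {c}. w d) = (\<Prod>d\<in>children p. w d) * (1 / w c)"
    if "c \<in> children p" for c
    using that assms subsetD[OF children_subset that] by (subst prod_diff1) auto
  then show ?thesis
    by (simp add: vertex_factor_def sum_distrib_left algebra_simps)
qed

end

text \<open>
  The root has a single child, so that the edge above this child lies above all other edges.
\<close>

locale pendant_rooted_tree = rooted_tree +
  fixes top :: 'a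
  assumes children_root: "children root = {top}"
begin

lemma top_in_Range: "top \<in> Range A"
  using children_root children_subset by blast

lemma desc_top: "desc top = Range A"
proof
  show "desc top \<subseteq> Range A" by (rule desc_subset_Range[OF top_in_Range])
  show "Range A \<subseteq> desc top"
    using mem_desc_root desc_unfold[of root] children_root root_no_parent by auto
qed

lemma Range_conv_children: "Range A = insert top (\<Union>p\<in>Range A. children p)"
  using Domain_subset children_root top_in_Range by (fastforce simp: children_def)

text \<open>
  Regrouping by parents: the product of the weights cleared from the denominators of the column
  operations is the one needed to turn the diagonal entries into \<^const>\<open>vertex_factor\<close>.
\<close>

lemma prod_Range_children:
  "(\<Prod>v\<in>Range A. w v) = w top * (\<Prod>p\<in>Range A. \<Prod>c\<in>children p. w c)" for w :: "'a \<Rightarrow> real"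
proof -
  have "top \<notin> (\<Union>p\<in>Range A. children p)"
    using children_root root_no_parent by (auto simp: children_def dest: parent_unique)
  moreover have "(\<Prod>v\<in>(\<Union>p\<in>Range A. children p). w v) = (\<Prod>p\<in>Range A. \<Prod>c\<in>children p. w c)"
  proof (rule prod.UNION_disjoint)
    show "\<forall>p\<in>Range A. \<forall>q\<in>Range A. p \<noteq> q \<longrightarrow> children p \<inter> children q = {}"
      by (auto simp: children_def dest: parent_unique)
  qed (use finite_Range in simp_all)
  ultimately show ?thesis
    using finite_Range by (subst Range_conv_children) simp
qed

lemma tree_kernel_top: "v \<in> Range A \<Longrightarrow> tree_kernel w top v = w top"
  using desc_top desc_antisym[of top v] by (auto simp: tree_kernel_def)

lemma det_tree_kernel_nonzero:
  assumes x: "bij_betw x {..<m} (Range A)"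
    and w: "\<And>v. v \<in> Range A \<Longrightarrow> w v \<noteq> 0" and "w top + 1 \<noteq> 0"
  shows "det (enum_mat m x (\<lambda>u v. tree_kernel w u v + 1)) =
           (w top + 1) * (\<Prod>p\<in>Range A. vertex_factor w p)"
proof -
  (* R subtracts the constant row of top, scaled to 1, from all other rows; Z holds the column
     operations. Thus R * M is the kernel itself outside the row of top, and T = R * M * Z. *)
  define M where "M u v = tree_kernel w u v + 1" for u v
  define R where "R u v = (if u = v then 1 else if v = top then - 1 / (w top + 1) else 0)" for u v
  define Z where "Z v p = (if v = p then 1 / w p else if v \<in> children p then - 1 / w v else 0)" for v p
  define RM where "RM u v = (if u = top then w top + 1 else tree_kernel w u v)" for u v
  define T where "T u p = RM u p / w p - (\<Sum>c\<in>children p. RM u c / w c)" for u p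
  have RM: "(\<Sum>k\<in>Range A. R u k * M k v) = RM u v" if uv: "u \<in> Range A" "v \<in> Range A" for u v
  proof -
    have "(\<Sum>k\<in>Range A. R u k * M k v) =
        (\<Sum>k\<in>Range A. (if k = u then M k v else 0) +
          (if k = top then (if u = top then 0 else - M k v / (w top + 1)) else 0))"
      by (rule sum.cong) (auto simp: R_def)
    also have "\<dots> = M u v + (if u = top then 0 else - (M top v / (w top + 1)))"
      using uv finite_Range top_in_Range by (simp add: sum.distrib)
    also have "M top v = w top + 1"
      using uv by (simp add: M_def tree_kernel_top)
    also have "M u v + (if u = top then 0 else - ((w top + 1) / (w top + 1))) = RM u v"
      using uv \<open>w top + 1 \<noteq> 0\<close> by (simp add: M_def RM_def tree_kernel_top)
    finally show ?thesis .
  qed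
  have T: "(\<Sum>k\<in>Range A. RM u k * Z k p) = T u p" if p: "p \<in> Range A" for u p
  proof -
    have "p \<notin> children p" using child_height by blast
    then have "(\<Sum>k\<in>Range A. RM u k * Z k p) =
        (\<Sum>k\<in>Range A. (if k = p then RM u k / w k else 0) +
          (if k \<in> children p then - (RM u k / w k) else 0))"
      by (intro sum.cong) (auto simp: Z_def)
    also have "\<dots> = RM u p / w p + (\<Sum>k\<in>Range A \<inter> children p. - (RM u k / w k))"
      using p finite_Range by (simp add: sum.distrib sum.inter_restrict)
    also have "Range A \<inter> children p = children p" using children_subset by blast
    finally show ?thesis by (simp add: T_def sum_negf)
  qed
  have "enum_mat m x R * enum_mat m x M = enum_mat m x RM"
    unfolding enum_mat_mult[OF x] by (rule enum_mat_cong[OF x RM])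
  moreover have "enum_mat m x RM * enum_mat m x Z = enum_mat m x T"
    unfolding enum_mat_mult[OF x] by (rule enum_mat_cong[OF x T])
  ultimately have prod: "det (enum_mat m x R) * det (enum_mat m x M) * det (enum_mat m x Z) = det (enum_mat m x T)"
    by (metis det_mult enum_mat_carrier)
  have "det (enum_mat m x R) = (\<Prod>v\<in>Range A. R v v)"
  proof (rule det_enum_mat_triangular[OF x, where r = "\<lambda>v. - int (h v)"])
    fix u v assume "u \<in> Range A" "v \<in> Range A" "R u v \<noteq> 0"
    then show "u = v \<or> - int (h u) < - int (h v)"
      using desc_height[of u top] by (auto simp: R_def desc_top split: if_splits)
  qed
  then have detR: "det (enum_mat m x R) = 1" by (simp add: R_def)
  have "det (enum_mat m x Z) = (\<Prod>v\<in>Range A. Z v v)"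
  proof (rule det_enum_mat_triangular[OF x, where r = "\<lambda>v. - int (h v)"])
    fix u v assume "Z u v \<noteq> 0"
    then show "u = v \<or> - int (h u) < - int (h v)"
      by (auto simp: Z_def child_height split: if_splits)
  qed
  then have detZ: "det (enum_mat m x Z) = 1 / (\<Prod>v\<in>Range A. w v)"
    by (simp add: Z_def prod_dividef)
  have "det (enum_mat m x T) = (\<Prod>v\<in>Range A. T v v)"
  proof (rule det_enum_mat_triangular[OF x, where r = "\<lambda>v. int (h v)"])
    fix u p assume up: "u \<in> Range A" "p \<in> Range A" "T u p \<noteq> 0"
    show "u = p \<or> int (h u) < int (h p)"
    proof (cases "u = top")
      case True
      then show ?thesis using desc_height[of p top] up by (auto simp: desc_top)
    next
      case False
      then show ?thesis
        using up tree_kernel_column[of w p u] w by (auto simp: T_def RM_def)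
    qed
  qed
  moreover have "T p p = (if p = top then (w top + 1) / w top else 1) *
      (1 - w p * (\<Sum>c\<in>children p. 1 / w c))" if p: "p \<in> Range A" for p
  proof (cases "p = top")
    case True
    have "T top top = (w top + 1) / w top - (w top + 1) * (\<Sum>c\<in>children top. 1 / w c)"
      by (simp add: T_def RM_def sum_distrib_left)
    then show ?thesis using True w[OF p] by (simp add: field_simps)
  next
    case False
    then show ?thesis
      using w[OF p] tree_kernel_column_diag[of w p] w
      by (simp add: T_def RM_def) (simp add: tree_kernel_def)
  qed
  ultimately have "det (enum_mat m x T) = (\<Prod>p\<in>Range A. (if p = top then (w top + 1) / w top else 1)) *
      (\<Prod>p\<in>Range A. 1 - w p * (\<Sum>c\<in>children p. 1 / w c))"
    by (simp add: prod.distrib)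
  also have "(\<Prod>p\<in>Range A. (if p = top then (w top + 1) / w top else 1)) = (w top + 1) / w top"
    using finite_Range top_in_Range by (simp add: prod.delta)
  finally have detT: "det (enum_mat m x T) = (w top + 1) / w top *
    (\<Prod>p\<in>Range A. 1 - w p * (\<Sum>c\<in>children p. 1 / w c))" .
  have nz: "(\<Prod>v\<in>Range A. w v) \<noteq> 0" using w finite_Range by simp
  have "det (enum_mat m x M) = det (enum_mat m x T) * (\<Prod>v\<in>Range A. w v)"
    using prod nz unfolding detR detZ by (simp add: field_simps)
  also have "\<dots> = (w top + 1) * ((\<Prod>p\<in>Range A. \<Prod>c\<in>children p. w c) *
       (\<Prod>p\<in>Range A. 1 - w p * (\<Sum>c\<in>children p. 1 / w c)))"
    unfolding detT prod_Range_children[of w] using w[OF top_in_Range] by simp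
  also have "\<dots> = (w top + 1) * (\<Prod>p\<in>Range A. vertex_factor w p)"
    using w by (simp add: vertex_factor_nonzero prod.distrib)
  finally show ?thesis unfolding M_def .
qed

text \<open>
  The case of vanishing weights is the limit \<open>\<epsilon> \<rightarrow> 0\<close> of the weights \<open>w + \<epsilon>\<close>, for which only finitely
  many \<open>\<epsilon>\<close> are exceptional.
\<close>

lemma det_tree_kernel:
  assumes x: "bij_betw x {..<m} (Range A)"
  shows "det (enum_mat m x (\<lambda>u v. tree_kernel w u v + 1)) =
           (w top + 1) * (\<Prod>p\<in>Range A. vertex_factor w p)"
proof (rule tendsto_unique)
  define W where "W \<epsilon> v = w v + \<epsilon>" for \<epsilon> v
  have W: "((\<lambda>\<epsilon>. W \<epsilon> v) \<longlongrightarrow> w v) (at 0)" for v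
    unfolding W_def by (auto intro!: tendsto_eq_intros)
  have K: "((\<lambda>\<epsilon>. tree_kernel (W \<epsilon>) u v) \<longlongrightarrow> tree_kernel w u v) (at 0)" for u v
    using W[of u] W[of v] by (simp add: tree_kernel_def)
  let ?det = "\<lambda>\<epsilon>. det (enum_mat m x (\<lambda>u v. tree_kernel (W \<epsilon>) u v + 1))"
  show "(?det \<longlongrightarrow> det (enum_mat m x (\<lambda>u v. tree_kernel w u v + 1))) (at 0)"
    unfolding det_enum_mat by (intro tendsto_intros K)
  have ev: "\<forall>\<^sub>F \<epsilon> in at 0. \<forall>a\<in>uminus ` w ` Range A \<union> {- w top - 1}. \<epsilon> \<noteq> a"
    using finite_Range
    by (intro eventually_ball_finite ballI eventually_neq_at_within) simp
  have "\<forall>\<^sub>F \<epsilon> in at 0. ?det \<epsilon> = (W \<epsilon> top + 1) * (\<Prod>p\<in>Range A. vertex_factor (W \<epsilon>) p)"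
    using ev
  proof eventually_elim
    case (elim \<epsilon>)
    then show ?case
      by (intro det_tree_kernel_nonzero[OF x]) (auto simp: W_def add_eq_0_iff)
  qed
  moreover have "((\<lambda>\<epsilon>. (W \<epsilon> top + 1) * (\<Prod>p\<in>Range A. vertex_factor (W \<epsilon>) p)) \<longlongrightarrow>
      (w top + 1) * (\<Prod>p\<in>Range A. vertex_factor w p)) (at 0)"
    unfolding vertex_factor_def by (intro tendsto_intros W)
  ultimately show "(?det \<longlongrightarrow> (w top + 1) * (\<Prod>p\<in>Range A. vertex_factor w p)) (at 0)"
    by (simp add: tendsto_cong)
qed simp

end

section \<open>Paths and pair counts in rooted trees\<close>

text \<open>
  An unordered pair separated by both of two nested sets has one end inside the smaller and the other
  outside the larger. Replacing \<open>T\<close> by its complement covers disjoint sets as well.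
\<close>

lemma card_separated_pairs:
  assumes "finite L" "S \<inter> L \<subseteq> T"
  shows "card {{a, b} | a b. a \<in> L \<and> b \<in> L \<and> a \<noteq> b \<and>
      (a \<in> S) \<noteq> (b \<in> S) \<and> (a \<in> T) \<noteq> (b \<in> T)} = card (L \<inter> S) * card (L - T)"
proof -
  have "{{a, b} | a b. a \<in> L \<and> b \<in> L \<and> a \<noteq> b \<and> (a \<in> S) \<noteq> (b \<in> S) \<and> (a \<in> T) \<noteq> (b \<in> T)} =
      (\<lambda>(a, b). {a, b}) ` ((L \<inter> S) \<times> (L - T))" (is "?X = ?Y")
  proof (rule subset_antisym)
    show "?X \<subseteq> ?Y"
    proof
      fix e assume "e \<in> ?X"
      then obtain a b where e: "e = {a, b}" and ab: "a \<in> L" "b \<in> L"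
        "(a \<in> S) \<noteq> (b \<in> S)" "(a \<in> T) \<noteq> (b \<in> T)"
        by blast
      show "e \<in> ?Y"
      proof (cases "a \<in> S")
        case True
        then have "(a, b) \<in> (L \<inter> S) \<times> (L - T)" using ab assms(2) by auto
        then show ?thesis using e by force
      next
        case False
        then have "(b, a) \<in> (L \<inter> S) \<times> (L - T)" using ab assms(2) by auto
        then show ?thesis using e by (force simp: insert_commute)
      qed
    qed
    show "?Y \<subseteq> ?X"
    proof
      fix e assume "e \<in> ?Y"
      then obtain a b where e: "e = {a, b}" and "a \<in> L" "a \<in> S" "b \<in> L" "b \<notin> T" by auto
      moreover from this have "a \<in> T" "b \<notin> S" "a \<noteq> b" using assms(2) by auto
      ultimately show "e \<in> ?X" by blast
    qed
  qed
  moreover have "inj_on (\<lambda>(a, b). {a, b}) ((L \<inter> S) \<times> (L - T))"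
    using assms(2) by (auto simp: inj_on_def doubleton_eq_iff)
  ultimately show ?thesis
    by (simp add: card_image card_cartesian_product)
qed

lemma path_edges_Cons: "path_edges (a # b # p) = insert {a, b} (path_edges (b # p))"
  by (simp add: path_edges_def)

lemma path_edges_subset: "e \<in> path_edges p \<Longrightarrow> e \<subseteq> set p"
proof (induction p rule: vwalk_arcs.induct)
  case (3 a b p)
  then show ?case by (auto simp: path_edges_Cons)
qed (auto simp: path_edges_def)

lemma vpath_Cons:
  "vpath (a # b # p) (with_proj G) \<longleftrightarrow>
     a \<in> pverts G \<and> (a, b) \<in> parcs G \<and> a \<notin> set (b # p) \<and> vpath (b # p) (with_proj G)"
  by (auto simp: vpath_def vwalk_def arcs_ends_def arc_to_ends_def)

locale rooted_tree_graph = pendant_rooted_tree +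
  fixes G :: "'a pair_pre_digraph"
  assumes parcs_G: "parcs G = A \<union> A\<inverse>"
    and pverts_G: "pverts G = insert root (Range A)"
begin

lemma pair_graph_G: "pair_graph G"
proof
  show "finite (pverts G)" "finite (parcs G)"
    using finite_Range finite_arcs by (simp_all add: parcs_G pverts_G)
  show "symmetric (with_proj G)"
    by (auto simp: symmetric_def parcs_G sym_def)
next
  fix e assume "e \<in> parcs G"
  then show "fst e \<in> pverts G" "snd e \<in> pverts G" "fst e \<noteq> snd e"
    using Domain_subset height_less by (cases e; auto simp: parcs_G pverts_G)+
qed

definition edge_above :: "'a \<Rightarrow> 'a set" where
  "edge_above v = insert v {u. (u, v) \<in> A}"

lemma edge_above_arc: "(u, v) \<in> A \<Longrightarrow> edge_above v = {u, v}"
  by (auto simp: edge_above_def dest: parent_unique)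

lemma edges_G: "edges G = edge_above ` Range A"
proof (intro equalityI subsetI)
  fix e assume "e \<in> edges G"
  then obtain u v where "e = {u, v}" "(u, v) \<in> A"
    by (force simp: edges_def parcs_G insert_commute)
  then have "v \<in> Range A" "e = edge_above v" by (auto simp: edge_above_arc)
  then show "e \<in> edge_above ` Range A" by (rule rev_image_eqI)
next
  fix e assume "e \<in> edge_above ` Range A"
  then obtain u v where uv: "(u, v) \<in> A" "e = edge_above v" by blast
  then have "e = {u, v}" by (simp add: edge_above_arc)
  then show "e \<in> edges G"
    using uv(1) by (force simp: edges_def parcs_G)
qed

lemma inj_on_edge_above: "inj_on edge_above (Range A)"
proof (rule inj_onI)
  fix v v' assume "v \<in> Range A" "v' \<in> Range A" and eq: "edge_above v = edge_above v'"
  then obtain u u' where u: "(u, v) \<in> A" "(u', v') \<in> A" by blast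
  with eq have "{u, v} = {u', v'}" by (simp add: edge_above_arc)
  then show "v = v'"
    using u[THEN height_less] by (auto simp: doubleton_eq_iff)
qed

text \<open>
  The edge above \<open>v\<close> is the only bridge between the vertices below \<open>v\<close> and all others.
\<close>

lemma edge_above_iff_crossing:
  assumes "(x, y) \<in> parcs G" "v \<in> Range A"
  shows "edge_above v = {x, y} \<longleftrightarrow> (x \<in> desc v) \<noteq> (y \<in> desc v)"
proof -
  have arc: "edge_above v = {a, b} \<longleftrightarrow> (a \<in> desc v) \<noteq> (b \<in> desc v)" if ab: "(a, b) \<in> A" for a b
  proof -
    have "edge_above v = {a, b} \<longleftrightarrow> v = b"
      using inj_on_edge_above assms(2) ab edge_above_arc[OF ab] by (auto dest: inj_onD)
    moreover have "a \<notin> desc b"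
      using desc_height[of a b] height_less[OF ab] by auto
    moreover have "a \<in> desc v \<Longrightarrow> b \<in> desc v"
      using ab by (auto simp: desc_def)
    moreover have "b \<in> desc v \<Longrightarrow> b \<noteq> v \<Longrightarrow> a \<in> desc v"
      by (rule parent_in_desc[OF _ _ ab])
    ultimately show ?thesis by auto
  qed
  show ?thesis
    using assms(1) arc[of x y] arc[of y x] by (auto simp: parcs_G insert_commute)
qed

text \<open>
  A path crosses this bridge at most once, because its vertices are distinct. So it uses the bridge
  exactly if its ends lie on different sides.
\<close>

lemma edge_above_in_path_iff:
  assumes "vpath p (with_proj G)" "v \<in> Range A"
  shows "edge_above v \<in> path_edges p \<longleftrightarrow> (hd p \<in> desc v) \<noteq> (last p \<in> desc v)"
  using assms(1)
proof (induction p rule: vwalk_arcs.induct)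
  case 1
  then show ?case by (simp add: vpath_def vwalk_def)
next
  case (2 a)
  then show ?case by (simp add: path_edges_def)
next
  case (3 a b p)
  then have ab: "(a, b) \<in> parcs G" "a \<notin> set (b # p)" and IH:
    "edge_above v \<in> path_edges (b # p) \<longleftrightarrow> (b \<in> desc v) \<noteq> (last (b # p) \<in> desc v)"
    by (simp_all add: vpath_Cons)
  have "{a, b} \<notin> path_edges (b # p)"
    using path_edges_subset ab(2) by blast
  then show ?case
    using edge_above_iff_crossing[OF ab(1) assms(2)] IH by (auto simp: path_edges_Cons)
qed

lemma path_edges_subset_edges: "vpath p (with_proj G) \<Longrightarrow> path_edges p \<subseteq> edges G"
proof (induction p rule: vwalk_arcs.induct)
  case (3 a b p)
  then show ?case by (auto simp: path_edges_Cons vpath_Cons edges_def)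
qed (auto simp: path_edges_def)

lemma path_edges_eq:
  assumes "vpath p (with_proj G)"
  shows "path_edges p = edge_above ` {v \<in> Range A. (hd p \<in> desc v) \<noteq> (last p \<in> desc v)}"
  using path_edges_subset_edges[OF assms] edge_above_in_path_iff[OF assms]
  by (fastforce simp: edges_G)

text \<open>
  By the previous lemma the ends of a path determine its edges, and the edges determine the vertices
  one by one: only the first edge of a path contains its first vertex.
\<close>

lemma vpath_unique:
  assumes "vpath p (with_proj G)" "vpath q (with_proj G)" "hd p = hd q" "last p = last q"
  shows "p = q"
  using assms
proof (induction p arbitrary: q rule: vwalk_arcs.induct)
  case 1
  then show ?case by (simp add: vpath_def vwalk_def)
next
  case (2 a)
  then show ?case
    by (cases q) (auto simp: vpath_def vwalk_def split: if_splits)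
next
  case (3 a b p)
  then obtain q' where q: "q = a # q'" by (cases q) (auto simp: vpath_def vwalk_def)
  have ab: "a \<notin> set (b # p)" "vpath (b # p) (with_proj G)" using "3.prems" by (simp_all add: vpath_Cons)
  have "last (b # p) \<in> set (b # p)" by (rule last_in_set) simp
  with ab "3.prems"(4) q obtain b' r where q': "q' = b' # r"
    by (cases q') auto
  have ab': "a \<notin> set (b' # r)" "vpath (b' # r) (with_proj G)"
    using "3.prems"(2) by (simp_all add: vpath_Cons q q')
  have "path_edges (a # b # p) = path_edges (a # b' # r)"
    using "3.prems" by (simp add: path_edges_eq q q')
  then have "{a, b} \<in> insert {a, b'} (path_edges (b' # r))"
    by (metis insertI1 path_edges_Cons)
  moreover have "{a, b} \<notin> path_edges (b' # r)"
    using path_edges_subset ab'(1) by blast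
  ultimately have "b = b'" by (auto simp: doubleton_eq_iff)
  then have "b # p = b' # r"
    using "3.prems"(4) ab ab' by (intro "3.IH") (auto simp: q q')
  then show ?case by (simp add: q q')
qed

lemma reachable_G:
  assumes "u \<in> pverts G" "v \<in> pverts G"
  shows "u \<rightarrow>\<^sup>*\<^bsub>with_proj G\<^esub> v"
proof -
  interpret pair_graph G by (rule pair_graph_G)
  have "root \<rightarrow>\<^sup>*\<^bsub>with_proj G\<^esub> v" if v: "v \<in> pverts G" for v
  proof -
    have "(root, v) \<in> A\<^sup>*"
      using mem_desc_root v by (auto simp: desc_def pverts_G)
    then show ?thesis
    proof (induction rule: rtrancl_induct)
      case base
      show ?case by (rule reachable_refl) (simp add: pverts_G)
    next
      case (step y z)
      then show ?case by (intro reachable_adj_trans[OF step.IH]) (auto simp: parcs_G)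
    qed
  qed
  then show ?thesis
    using assms symmetric_reachable' reachable_trans by blast
qed

lemma connecting_path_G:
  assumes "a \<in> pverts G" "b \<in> pverts G"
  defines "p \<equiv> connecting_path G a b"
  shows "vpath p (with_proj G)" "hd p = a" "last p = b"
proof -
  interpret pair_graph G by (rule pair_graph_G)
  obtain q where "vpath q (with_proj G)" "hd q = a" "last q = b"
    using reachable_G[OF assms(1,2)] unfolding reachable_vpath_conv by blast
  then have "\<exists>!q. vpath q (with_proj G) \<and> hd q = a \<and> last q = b"
    using vpath_unique by metis
  from theI'[OF this] show "vpath p (with_proj G)" "hd p = a" "last p = b"
    unfolding p_def connecting_path_def by blast+
qed

lemma out_degree_G:
  assumes "v \<in> Range A"
  shows "out_degree (with_proj G) v = Suc (card (children v))"
proof -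
  obtain u where u: "(u, v) \<in> A" using assms by blast
  then have "out_arcs (with_proj G) v = Pair v ` insert u (children v)"
    by (auto simp: out_arcs_def parcs_G children_def dest: parent_unique)
  moreover have "u \<notin> children v"
    using child_height[of u v] height_less[OF u] by auto
  ultimately show ?thesis
    by (simp add: out_degree_def card_image inj_on_def del: image_insert)
qed

lemma boundary_G: "boundary G = insert root {v \<in> Range A. children v = {}}"
proof -
  have "out_arcs (with_proj G) root = Pair root ` children root"
    using root_no_parent by (auto simp: out_arcs_def parcs_G children_def)
  then have "out_degree (with_proj G) root = 1"
    by (simp add: out_degree_def children_root)
  moreover have "out_degree (with_proj G) v = 1 \<longleftrightarrow> children v = {}" if "v \<in> Range A" for v
    using that by (simp add: out_degree_G)
  ultimately show ?thesis
    unfolding boundary_def pverts_G by blast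
qed

lemma finite_boundary: "finite (boundary G)"
  using finite_Range by (simp add: boundary_G)

definition leaves_below :: "'a \<Rightarrow> nat" where
  "leaves_below v = card (boundary G \<inter> desc v)"

lemma pair_count_edges:
  assumes "u \<in> Range A" "v \<in> Range A"
  shows "pair_count G {edge_above u, edge_above v} =
    card {{a, b} | a b. a \<in> boundary G \<and> b \<in> boundary G \<and> a \<noteq> b \<and>
      (a \<in> desc u) \<noteq> (b \<in> desc u) \<and> (a \<in> desc v) \<noteq> (b \<in> desc v)}"
proof -
  have "a \<in> boundary G \<and> b \<in> boundary G \<and> a \<noteq> b \<and>
      {edge_above u, edge_above v} \<subseteq> path_edges (connecting_path G a b) \<longleftrightarrow>
      a \<in> boundary G \<and> b \<in> boundary G \<and> a \<noteq> b \<and>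
      (a \<in> desc u) \<noteq> (b \<in> desc u) \<and> (a \<in> desc v) \<noteq> (b \<in> desc v)" for a b
  proof (cases "a \<in> boundary G \<and> b \<in> boundary G")
    case True
    then have "a \<in> pverts G" "b \<in> pverts G" by (auto simp: boundary_def)
    note p = connecting_path_G[OF this]
    show ?thesis
      using edge_above_in_path_iff[OF p(1)] assms by (simp add: p(2,3))
  qed auto
  then show ?thesis by (simp only: pair_count_def)
qed

lemma pair_count_nested:
  assumes "v \<in> Range A" "u \<in> desc v"
  shows "pair_count G {edge_above u, edge_above v} =
    leaves_below u * (card (boundary G) - leaves_below v)"
proof -
  have u: "u \<in> Range A" using assms desc_subset_Range by blast
  have "desc u \<subseteq> desc v" using assms desc_trans by blast
  then have "pair_count G {edge_above u, edge_above v} =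
      card (boundary G \<inter> desc u) * card (boundary G - desc v)"
    unfolding pair_count_edges[OF u assms(1)]
    by (intro card_separated_pairs finite_boundary) auto
  then show ?thesis
    using finite_boundary by (simp add: leaves_below_def card_Diff_subset_Int)
qed

text \<open>
  The complement of \<open>desc v\<close> separates the same pairs as \<open>desc v\<close>, and it contains \<open>desc u\<close>.
\<close>

lemma pair_count_disjoint:
  assumes "u \<in> Range A" "v \<in> Range A" "u \<notin> desc v" "v \<notin> desc u"
  shows "pair_count G {edge_above u, edge_above v} = leaves_below u * leaves_below v"
proof -
  have "desc u \<inter> desc v = {}"
    using assms(3,4) desc_laminar by blast
  then have "card {{a, b} | a b. a \<in> boundary G \<and> b \<in> boundary G \<and> a \<noteq> b \<and>
      (a \<in> desc u) \<noteq> (b \<in> desc u) \<and> (a \<in> - desc v) \<noteq> (b \<in> - desc v)} =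
    card (boundary G \<inter> desc u) * card (boundary G - - desc v)"
    by (intro card_separated_pairs finite_boundary) auto
  then show ?thesis
    unfolding pair_count_edges[OF assms(1,2)]
    by (simp add: leaves_below_def Diff_eq)
qed

text \<open>
  A vertex of maximal height below \<open>v\<close> is a leaf.
\<close>

lemma leaves_below_pos:
  assumes "v \<in> Range A"
  shows "leaves_below v > 0"
proof -
  have "finite (h ` desc v)" "h ` desc v \<noteq> {}"
    using finite_desc[OF assms] desc_refl[of v] by blast+
  then have "Max (h ` desc v) \<in> h ` desc v" "\<forall>y\<in>desc v. h y \<le> Max (h ` desc v)"
    by (rule Max_in) (use \<open>finite (h ` desc v)\<close> in simp)
  then obtain u where u: "u \<in> desc v" "\<And>y. y \<in> desc v \<Longrightarrow> h y \<le> h u"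
    by auto
  have "c \<notin> children u" for c
    using u(2)[of c] desc_trans[OF child_in_desc u(1)] child_height[of c u] by force
  then have "children u = {}" by blast
  moreover have "u \<in> Range A" using u(1) assms desc_subset_Range by blast
  ultimately have "u \<in> boundary G \<inter> desc v" using u(1) by (simp add: boundary_G)
  then show ?thesis
    using finite_boundary by (auto simp: leaves_below_def card_gt_0_iff)
qed

lemma leaves_below_less:
  assumes "v \<in> Range A"
  shows "leaves_below v < card (boundary G)"
proof -
  have "root \<notin> desc v" using desc_subset_Range[OF assms] root_no_parent by blast
  then have "boundary G \<inter> desc v \<subset> boundary G" by (auto simp: boundary_G)
  then show ?thesis
    unfolding leaves_below_def by (intro psubset_card_mono finite_boundary)
qed

lemma leaves_below_leaf:
  assumes "v \<in> Range A" "children v = {}"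
  shows "leaves_below v = 1"
  using assms desc_unfold[of v] by (simp add: leaves_below_def boundary_G)

lemma leaves_below_internal:
  assumes "v \<in> Range A" "children v \<noteq> {}"
  shows "leaves_below v = (\<Sum>c\<in>children v. leaves_below c)"
proof -
  have "v \<notin> boundary G" using assms root_no_parent by (auto simp: boundary_G)
  then have "boundary G \<inter> desc v = (\<Union>c\<in>children v. boundary G \<inter> desc c)"
    by (subst desc_unfold) auto
  moreover have "card (\<Union>c\<in>children v. boundary G \<inter> desc c) =
      (\<Sum>c\<in>children v. card (boundary G \<inter> desc c))"
    using finite_boundary siblings_desc_disjoint by (intro card_UN_disjoint) fastforce+
  ultimately show ?thesis by (simp add: leaves_below_def)
qed

lemma leaves_below_top: "leaves_below top = card (boundary G) - 1"
proof -
  have "boundary G \<inter> desc top = boundary G - {root}"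
    using root_no_parent by (auto simp: desc_top boundary_G)
  moreover have "root \<in> boundary G" by (simp add: boundary_G)
  ultimately show ?thesis
    using finite_boundary by (simp add: leaves_below_def)
qed

text \<open>
  The weight for which \<open>imbalance v + 1\<close> is the ratio of the numbers of boundary vertices on the two
  sides of the edge above \<open>v\<close>; it is \<open>0\<close> for an edge that halves the boundary.
\<close>

definition imbalance :: "'a \<Rightarrow> real" where
  "imbalance v = (real (card (boundary G)) - 2 * real (leaves_below v)) / real (leaves_below v)"

lemma Q_entry:
  assumes "u \<in> Range A" "v \<in> Range A"
  shows "real (pair_count G {edge_above u, edge_above v}) /
      (real (pair_count G {edge_above u}) * real (pair_count G {edge_above v})) =
    1 / (real (card (boundary G)) - leaves_below u) * (1 / (real (card (boundary G)) - leaves_below v)) *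
      (tree_kernel imbalance u v + 1)"
proof -
  define n where "n = real (card (boundary G))"
  have s: "real (leaves_below w) > 0" "n - real (leaves_below w) > 0" if "w \<in> Range A" for w
    using leaves_below_pos[OF that] leaves_below_less[OF that] by (auto simp: n_def)
  have nested: "real (pair_count G {edge_above a, edge_above b}) = leaves_below a * (n - leaves_below b)"
    if "b \<in> Range A" "a \<in> desc b" for a b
    using pair_count_nested[OF that] leaves_below_less[OF that(1)] by (simp add: n_def of_nat_diff)
  have q: "real (pair_count G {edge_above w}) = leaves_below w * (n - leaves_below w)"
    if "w \<in> Range A" for w
    using nested[of w w] that by simp
  have imb: "imbalance w + 1 = (n - leaves_below w) / leaves_below w" if "w \<in> Range A" for w
    using s[OF that] by (simp add: imbalance_def n_def field_simps)
  note pos = s[OF assms(1)] s[OF assms(2)]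
  consider "u \<in> desc v" | "u \<notin> desc v" "v \<in> desc u" | "u \<notin> desc v" "v \<notin> desc u" by blast
  then have "real (pair_count G {edge_above u, edge_above v}) /
      (real (pair_count G {edge_above u}) * real (pair_count G {edge_above v})) =
    1 / (n - leaves_below u) * (1 / (n - leaves_below v)) * (tree_kernel imbalance u v + 1)"
  proof cases
    case 1
    then have "tree_kernel imbalance u v + 1 = (n - leaves_below v) / leaves_below v"
      using imb[OF assms(2)] by (simp add: tree_kernel_def)
    then show ?thesis
      using 1 nested[of v u] assms pos by (simp add: q)
  next
    case 2
    then have "tree_kernel imbalance u v + 1 = (n - leaves_below u) / leaves_below u"
      using imb[OF assms(1)] by (simp add: tree_kernel_def)
    then show ?thesis
      using 2 nested[of u v] assms pos by (simp add: q insert_commute)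
  next
    case 3
    then show ?thesis
      using pair_count_disjoint[of u v] assms pos by (simp add: tree_kernel_def q)
  qed
  then show ?thesis by (simp add: n_def)
qed

end

section \<open>The determinant for rooted binary trees\<close>

locale rooted_binary_tree_graph = rooted_tree_graph +
  assumes binary: "v \<in> Range A \<Longrightarrow> children v \<noteq> {} \<Longrightarrow> card (children v) = 2"
begin

text \<open>
  With \<open>a\<close>, \<open>b\<close> the numbers of leaves below the two children and $c = n - a - b$, this is the identity
  $(n-2a)(n-2b)(a+b) - (n-2a-2b)\,(a(n-2b) + b(n-2a)) = 4abc$.
\<close>

lemma vertex_factor_internal:
  assumes "v \<in> Range A" "children v \<noteq> {}"
  shows "vertex_factor imbalance v = 4 * (real (card (boundary G)) - leaves_below v) / leaves_below v"
proof -
  obtain a b where ab: "children v = {a, b}" "a \<noteq> b"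
    using binary[OF assms] by (auto simp: card_2_iff)
  then have "a \<in> Range A" "b \<in> Range A" using children_subset[of v] by auto
  note pos = this[THEN leaves_below_pos]
  have "real (leaves_below v) = real (leaves_below a) + real (leaves_below b)"
    using leaves_below_internal[OF assms] ab by simp
  moreover have "{a, b} - {a} = {b}" "{a, b} - {b} = {a}" using ab by auto
  ultimately show ?thesis
    using ab pos by (simp add: vertex_factor_def imbalance_def divide_simps) (simp add: algebra_simps)
qed

text \<open>
  The squared scaling factors \<open>1 / (n - s)\<close> cancel one factor \<open>n - s\<close> of each internal vertex; the
  leaves, where \<open>s = 1\<close>, and the factor \<open>imbalance top + 1 = 1 / (n - 1)\<close> give the power of \<open>n - 1\<close>.
\<close>

lemma det_Q_mat:
  assumes e: "edge_enum G e"
  shows "det (Q_mat G e) =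
    (\<Prod>v\<in>{v \<in> Range A. children v \<noteq> {}}. 4 / (leaves_below v * (real (card (boundary G)) - leaves_below v)))
      / (real (card (boundary G)) - 1) ^ (2 * card (boundary G) - 1)"
proof -
  define m where "m = card (edges G)"
  define n where "n = card (boundary G)"
  define I where "I = {v \<in> Range A. children v \<noteq> {}}"
  define L where "L = {v \<in> Range A. children v = {}}"
  define s where "s v = real (leaves_below v)" for v
  define x where "x i = inv_into (Range A) edge_above (e i)" for i
  have e': "bij_betw e {..<m} (edges G)"
    using e by (simp add: edge_enum_def m_def)
  have "bij_betw edge_above (Range A) (edges G)"
    using inj_on_edge_above by (simp add: bij_betw_def edges_G)
  from bij_betw_trans[OF e' bij_betw_inv_into[OF this]]
  have x: "bij_betw x {..<m} (Range A)" by (simp add: x_def[abs_def] o_def)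
  have xe: "x i \<in> Range A" "edge_above (x i) = e i" if "i < m" for i
    using bij_betwE[OF e'] that unfolding x_def edges_G
    by (auto intro!: inv_into_into f_inv_into_f)
  have "Q_mat G e = enum_mat m x (\<lambda>u v. 1 / (real n - s u) * (1 / (real n - s v)) *
      (tree_kernel imbalance u v + 1))"
    unfolding Q_mat_def enum_mat_def m_def[symmetric]
    using Q_entry[OF xe(1) xe(1)] by (intro cong_mat) (simp_all add: xe(2) n_def s_def)
  then have "det (Q_mat G e) = (\<Prod>v\<in>Range A. 1 / (real n - s v))\<^sup>2 *
      ((imbalance top + 1) * (\<Prod>p\<in>Range A. vertex_factor imbalance p))"
    by (simp only: det_enum_mat_scale[OF x] det_tree_kernel[OF x])
  moreover have split: "Range A = I \<union> L" "I \<inter> L = {}" "finite I" "finite L"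
    using finite_Range by (auto simp: I_def L_def)
  have prod_split: "(\<Prod>v\<in>Range A. f v) = (\<Prod>v\<in>I. f v) * (\<Prod>v\<in>L. f v)" for f :: "'a \<Rightarrow> real"
    using split by (simp add: prod.union_disjoint)
  have n: "n = Suc (card L)"
    using split root_no_parent by (simp add: n_def boundary_G L_def)
  have "0 < card L"
    using leaves_below_pos[OF top_in_Range] n leaves_below_top by (simp add: n_def)
  then have n1: "real n - 1 > 0" using n by simp
  have "(\<Prod>v\<in>Range A. 1 / (real n - s v)) = (\<Prod>v\<in>I. 1 / (real n - s v)) * (1 / (real n - 1)) ^ (n - 1)"
    unfolding prod_split using leaves_below_leaf n by (simp add: L_def s_def)
  moreover have "(\<Prod>p\<in>Range A. vertex_factor imbalance p) = (\<Prod>v\<in>I. 4 * (real n - s v) / s v)"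
    unfolding prod_split using vertex_factor_internal
    by (simp add: I_def L_def s_def n_def vertex_factor_def)
  moreover have "imbalance top + 1 = 1 / (real n - 1)"
    using leaves_below_top n1 n by (simp add: imbalance_def n_def[symmetric] of_nat_diff field_simps)
  ultimately have "det (Q_mat G e) =
      ((\<Prod>v\<in>I. 1 / (real n - s v)) * (1 / (real n - 1)) ^ (n - 1))\<^sup>2 *
       (1 / (real n - 1) * (\<Prod>v\<in>I. 4 * (real n - s v) / s v))"
    by simp
  also have "\<dots> = ((\<Prod>v\<in>I. 1 / (real n - s v))\<^sup>2 * (\<Prod>v\<in>I. 4 * (real n - s v) / s v)) *
      (1 / (real n - 1)) ^ Suc ((n - 1) * 2)"
    by (simp add: power_mult_distrib power_mult)
  also have "(\<Prod>v\<in>I. 1 / (real n - s v))\<^sup>2 * (\<Prod>v\<in>I. 4 * (real n - s v) / s v) =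
      (\<Prod>v\<in>I. 4 / (s v * (real n - s v)))"
    unfolding power2_eq_square prod.distrib[symmetric]
    using leaves_below_less by (intro prod.cong) (auto simp: I_def s_def n_def divide_simps)
  also have "Suc ((n - 1) * 2) = 2 * n - 1" using n by simp
  finally show ?thesis
    by (simp add: I_def n_def s_def power_one_over)
qed

end

section \<open>The trees $C_{n,k}$\<close>

lemma rooted_tree_C_arcs:
  assumes "2 \<le> k" "k \<le> n - 4"
  shows "rooted_tree (C_arcs n k) (C_height k) (Spine 0)"
proof
  show "finite (C_arcs n k)"
    unfolding C_arcs_def by (auto simp: setcompr_eq_image)
  show "Domain (C_arcs n k) \<subseteq> insert (Spine 0) (Range (C_arcs n k))"
  proof
    fix v assume "v \<in> Domain (C_arcs n k)"
    then obtain w where "(v, w) \<in> C_arcs n k" by blast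
    then show "v \<in> insert (Spine 0) (Range (C_arcs n k))"
      using assms by (cases v) (auto simp: C_arcs_iff Range_iff)
  qed
  show "Spine 0 \<notin> Range (C_arcs n k)"
    by (auto simp: C_arcs_iff)
qed (fact C_arcs_parent_unique C_arcs_height)+

lemma Range_C_arcs:
  assumes "2 \<le> k" "k \<le> n - 4"
  shows "Range (C_arcs n k) =
    Spine ` {1..n - 2} \<union> Leaf ` ({1..n - 3} - {k}) \<union> {Hub, HubLeaf1, HubLeaf2}"
proof (rule Set.set_eqI)
  fix v
  show "v \<in> Range (C_arcs n k) \<longleftrightarrow>
      v \<in> Spine ` {1..n - 2} \<union> Leaf ` ({1..n - 3} - {k}) \<union> {Hub, HubLeaf1, HubLeaf2}"
    by (cases v) (simp_all add: Range_iff C_arcs_iff image_iff)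
qed

lemma C_arcs_children:
  assumes "2 \<le> k" "k \<le> n - 4"
  shows "C_arcs n k `` {Spine 0} = {Spine 1}"
    "t \<in> {1..n - 3} \<Longrightarrow> C_arcs n k `` {Spine t} = {Spine (Suc t), if t = k then Hub else Leaf t}"
    "C_arcs n k `` {Spine (n - 2)} = {}"
    "C_arcs n k `` {Leaf t} = {}"
    "C_arcs n k `` {Hub} = {HubLeaf1, HubLeaf2}"
    "C_arcs n k `` {HubLeaf1} = {}"
    "C_arcs n k `` {HubLeaf2} = {}"
  using assms by (auto simp: Image_singleton C_arcs_iff)

lemma C_arcs_internal:
  assumes "2 \<le> k" "k \<le> n - 4"
  shows "{v \<in> Range (C_arcs n k). C_arcs n k `` {v} \<noteq> {}} = insert Hub (Spine ` {1..n - 3})"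
proof (rule Set.set_eqI)
  fix v
  show "v \<in> {v \<in> Range (C_arcs n k). C_arcs n k `` {v} \<noteq> {}} \<longleftrightarrow> v \<in> insert Hub (Spine ` {1..n - 3})"
  proof (cases v)
    case (Spine t)
    consider "t = 0" | "t \<in> {1..n - 3}" | "t = n - 2" | "t > n - 2" using assms by force
    then show ?thesis
      by cases (use assms Spine in \<open>auto simp: Range_C_arcs[OF assms] C_arcs_children[OF assms] image_iff\<close>)
  qed (use assms in \<open>auto simp: Range_C_arcs[OF assms] C_arcs_children[OF assms] image_iff\<close>)
qed

lemma rooted_binary_tree_graph_C_tree:
  assumes "2 \<le> k" "k \<le> n - 4"
  shows "rooted_binary_tree_graph (C_arcs n k) (C_height k) (Spine 0) (Spine 1) (C_tree n k)"
proof -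
  interpret rooted_tree "C_arcs n k" "C_height k" "Spine 0"
    by (rule rooted_tree_C_arcs[OF assms])
  show ?thesis
  proof
    show "children (Spine 0) = {Spine 1}"
      using C_arcs_children(1)[OF assms] by (simp add: children_def)
    show "parcs (C_tree n k) = C_arcs n k \<union> (C_arcs n k)\<inverse>"
      by (simp add: C_tree_def)
    show "pverts (C_tree n k) = insert (Spine 0) (Range (C_arcs n k))"
      unfolding Range_C_arcs[OF assms] C_tree_def by (auto simp: image_iff)
  next
    fix v assume "v \<in> Range (C_arcs n k)" "children v \<noteq> {}"
    then have "v \<in> insert Hub (Spine ` {1..n - 3})"
      using C_arcs_internal[OF assms] by (auto simp: children_def)
    then show "card (children v) = 2"
      by (auto simp: children_def C_arcs_children[OF assms])
  qed
qed

text \<open>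
  The numbers of leaves along the spine of $C_{n,k}$ jump by 2 at $v_k$. This product over all
  positions but the one skipped by the jump is the source of the factorials.
\<close>

lemma prod_skip:
  fixes f :: "nat \<Rightarrow> real"
  assumes "k < m"
  shows "(\<Prod>t\<in>{1..m - 1}. f (if t \<le> k then t else Suc t)) * f (Suc k) = (\<Prod>t\<in>{1..m}. f t)"
proof -
  have "(\<Prod>t\<in>{1..m - 1}. f (if t \<le> k then t else Suc t)) = (\<Prod>t\<in>{1..m} - {Suc k}. f t)"
    by (rule prod.reindex_bij_witness[where i = "\<lambda>t. if t \<le> k then t else t - 1" and
          j = "\<lambda>t. if t \<le> k then t else Suc t"]) (use assms in auto)
  then show ?thesis
    using assms prod.remove[of "{1..m}" "Suc k" f] by (simp add: mult.commute)
qed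

text \<open>
  Completing the product over the spine by the factor $(k+1)(n-1-k)$ of the skipped position makes
  it $\prod_{t=1}^{n-2} t(n-t) = (n-2)!\,(n-1)!$.
\<close>

lemma det_Q_C_tree:
  assumes k: "2 \<le> k" "k \<le> n - 4" and e: "edge_enum (C_tree n k) e"
  shows "det (Q_mat (C_tree n k) e) =
    4 ^ (n - 2) * (real k + 1) * (real n - 1 - real k) /
      (2 * (real n - 2) * (real n - 1) ^ (2 * n) * (fact (n - 2))\<^sup>2)"
proof -
  interpret rooted_binary_tree_graph "C_arcs n k" "C_height k" "Spine 0" "Spine 1" "C_tree n k"
    by (rule rooted_binary_tree_graph_C_tree[OF k])
  (* \<sigma> t is the number of boundary vertices that are not below v_t. *)
  define \<sigma> where "\<sigma> t = (if t \<le> k then t else Suc t)" for t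
  have n: "n \<ge> 6" using k by simp
  note ch = C_arcs_children[OF k, folded children_def]
  have leaf: "leaves_below v = 1" if "v \<in> {Spine (n - 2), HubLeaf1, HubLeaf2} \<union> Leaf ` ({1..n - 3} - {k})" for v
    using that n by (intro leaves_below_leaf) (auto simp: Range_C_arcs[OF k] ch)
  have hub: "leaves_below Hub = 2"
    using leaves_below_internal[of Hub] leaf by (simp add: Range_C_arcs[OF k] ch)
  have spine: "leaves_below (Spine t) = n - \<sigma> t" if "1 \<le> t" "t \<le> n - 2" for t
    using that(2,1)
  proof (induction rule: inc_induct)
    case base
    then show ?case using leaf k n by (simp add: \<sigma>_def)
  next
    case (step t)
    then have t: "t \<in> {1..n - 3}" "t \<le> n - 2" by auto
    then have "leaves_below (Spine t) = leaves_below (Spine (Suc t)) + leaves_below (if t = k then Hub else Leaf t)"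
      using leaves_below_internal[of "Spine t"] by (simp add: Range_C_arcs[OF k] ch image_iff)
    then show ?case
      using step t k leaf hub by (auto simp: \<sigma>_def)
  qed
  have "(\<Prod>t\<in>{1..n - 3}. real (\<sigma> t) * (real n - \<sigma> t)) * (real (Suc k) * (real n - Suc k)) =
      (\<Prod>t\<in>{1..n - 2}. real t * (real n - t))"
    using prod_skip[of k "n - 2" "\<lambda>t. real t * (real n - t)"] k n by (simp add: \<sigma>_def numeral_3_eq_3 numeral_2_eq_2)
  also have "\<dots> = fact (n - 2) * (\<Prod>t\<in>{1..n - 2}. real n - t)"
    by (simp add: prod.distrib fact_prod)
  also have "(\<Prod>t\<in>{1..n - 2}. real n - t) = (\<Prod>t\<in>{2..n - 1}. real t)"
    by (rule prod.reindex_bij_witness[where i = "\<lambda>t. n - t" and j = "\<lambda>t. n - t"])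
       (use n in \<open>auto simp: of_nat_diff\<close>)
  also have "\<dots> = (\<Prod>t\<in>{1..n - 1}. real t)"
    using n by (intro prod.mono_neutral_left) auto
  also have "\<dots> = fact (n - 1)" by (simp add: fact_prod)
  also have "fact (n - 1) = (real n - 1) * fact (n - 2)"
    using n fact_reduce[of "n - 1", where 'a = real] by (simp add: of_nat_diff numeral_2_eq_2)
  finally have P: "(\<Prod>t\<in>{1..n - 3}. real (\<sigma> t) * (real n - \<sigma> t)) * ((real k + 1) * (real n - 1 - real k)) =
      (real n - 1) * (fact (n - 2))\<^sup>2"
    by (simp add: power2_eq_square algebra_simps)
  have "(\<Prod>v\<in>insert Hub (Spine ` {1..n - 3}). 4 / (leaves_below v * (real n - leaves_below v))) =
      4 / (2 * (real n - 2)) * (\<Prod>t\<in>{1..n - 3}. 4 / (leaves_below (Spine t) * (real n - leaves_below (Spine t))))"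
    by (simp add: hub image_iff prod.reindex inj_on_def)
  also have "(\<Prod>t\<in>{1..n - 3}. 4 / (leaves_below (Spine t) * (real n - leaves_below (Spine t)))) =
      (\<Prod>t\<in>{1..n - 3}. 4 / (real (\<sigma> t) * (real n - \<sigma> t)))"
  proof (rule prod.cong)
    fix t assume t: "t \<in> {1..n - 3}"
    then have "\<sigma> t \<le> n" "t \<le> n - 2" by (auto simp: \<sigma>_def)
    with t show "4 / (leaves_below (Spine t) * (real n - leaves_below (Spine t))) = 4 / (real (\<sigma> t) * (real n - \<sigma> t))"
      using spine[of t] by (simp add: of_nat_diff)
  qed simp
  also have "\<dots> = 4 ^ (n - 3) / (\<Prod>t\<in>{1..n - 3}. real (\<sigma> t) * (real n - \<sigma> t))"
    by (simp add: prod_dividef)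
  also have "\<dots> = 4 ^ (n - 3) * ((real k + 1) * (real n - 1 - real k)) / ((real n - 1) * (fact (n - 2))\<^sup>2)"
    unfolding P[symmetric] using k n by simp
  finally have I: "(\<Prod>v\<in>insert Hub (Spine ` {1..n - 3}). 4 / (leaves_below v * (real n - leaves_below v))) =
      4 / (2 * (real n - 2)) * (4 ^ (n - 3) * ((real k + 1) * (real n - 1 - real k)) / ((real n - 1) * (fact (n - 2))\<^sup>2))" .
  have pow: "(4::real) ^ (n - 2) = 4 * 4 ^ (n - 3)" "(real n - 1) ^ (2 * n) = (real n - 1) * (real n - 1) ^ (2 * n - 1)"
    using n by (simp_all flip: power_Suc add: Suc_diff_Suc numeral_3_eq_3 numeral_2_eq_2)
  have internal: "{v \<in> Range (C_arcs n k). children v \<noteq> {}} = insert Hub (Spine ` {1..n - 3})"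
    using C_arcs_internal[OF k] by (simp add: children_def)
  show ?thesis
    unfolding det_Q_mat[OF e] internal card_boundary_C_tree[OF k] I pow by (simp add: mult_ac)
qed

theorem mainTheorem2:
  fixes e1 e2 :: "nat \<Rightarrow> nat \<Rightarrow> cvertex set"
  assumes "\<And>n. even n \<Longrightarrow> 8 \<le> n \<Longrightarrow> edge_enum (G1 n) (e1 n)"
    and "\<And>n. even n \<Longrightarrow> 8 \<le> n \<Longrightarrow> edge_enum (G2 n) (e2 n)"
  shows
    "(\<forall>n::nat. even n \<and> 8 \<le> n \<longrightarrow>
        det (Q_mat (G1 n) (e1 n)) =
          4 ^ (n - 3) * real n ^ 2 /
          (2 * (real n - 1) ^ (2 * n) * (real n - 2) * (fact (n - 2)) ^ 2) \<and>
        det (Q_mat (G2 n) (e2 n)) =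
          6 * 4 ^ (n - 3) /
          ((real n - 1) ^ (2 * n) * (real n - 2) ^ 2 * fact (n - 4) * fact (n - 2)) \<and>
        det (Q_mat (G1 n) (e1 n)) / det (Q_mat (G2 n) (e2 n)) =
          1 / 12 * (real n ^ 2 / (real n - 3))) \<and>
     filterlim (\<lambda>n. det (Q_mat (G1 n) (e1 n)) / det (Q_mat (G2 n) (e2 n)))
       at_top (inf sequentially (principal {n. even n}))"
proof -
  have dets: "det (Q_mat (G1 n) (e1 n)) =
        4 ^ (n - 3) * real n ^ 2 /
        (2 * (real n - 1) ^ (2 * n) * (real n - 2) * (fact (n - 2)) ^ 2)"
      "det (Q_mat (G2 n) (e2 n)) =
        6 * 4 ^ (n - 3) /
        ((real n - 1) ^ (2 * n) * (real n - 2) ^ 2 * fact (n - 4) * fact (n - 2))"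
      "det (Q_mat (G1 n) (e1 n)) / det (Q_mat (G2 n) (e2 n)) =
        1 / 12 * (real n ^ 2 / (real n - 3))"
    if n: "even n" "8 \<le> n" for n
  proof -
    have pow: "(4::real) ^ (n - 2) = 4 * 4 ^ (n - 3)"
      using n by (simp flip: power_Suc add: Suc_diff_Suc numeral_3_eq_3 numeral_2_eq_2)
    have fact: "fact (n - 2) = (real n - 2) * (real n - 3) * fact (n - 4)"
    proof -
      have "n - 2 = Suc (Suc (n - 4))" using n by simp
      then have "(fact (n - 2) :: real) = real (Suc (Suc (n - 4))) * (real (Suc (n - 4)) * fact (n - 4))"
        by (simp only: fact_Suc of_nat_mult)
      then show ?thesis using n by (simp add: of_nat_diff)
    qed
    have pos: "real n - 1 > 0" "real n - 2 > 0" "real n - 3 > 0" using n by simp_all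
    from n obtain m where m: "n = 2 * m" by blast
    have k1: "2 \<le> n div 2 - 1" "n div 2 - 1 \<le> n - 4" "real (n div 2 - 1) = real n / 2 - 1"
      using n m by (simp_all add: of_nat_diff)
    have "det (Q_mat (G1 n) (e1 n)) =
        4 ^ (n - 2) * (real n / 2 - 1 + 1) * (real n - 1 - (real n / 2 - 1)) /
          (2 * (real n - 2) * (real n - 1) ^ (2 * n) * (fact (n - 2))\<^sup>2)"
      using det_Q_C_tree[OF k1(1,2), of "e1 n"] assms(1)[OF n] unfolding G1_def k1(3) by simp
    then show 1: "det (Q_mat (G1 n) (e1 n)) =
        4 ^ (n - 3) * real n ^ 2 /
        (2 * (real n - 1) ^ (2 * n) * (real n - 2) * (fact (n - 2)) ^ 2)"
      by (simp add: pow power2_eq_square mult_ac)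
    have "det (Q_mat (G2 n) (e2 n)) =
        4 ^ (n - 2) * (real 2 + 1) * (real n - 1 - real 2) /
          (2 * (real n - 2) * (real n - 1) ^ (2 * n) * (fact (n - 2))\<^sup>2)"
      using det_Q_C_tree[of 2 n "e2 n"] assms(2)[OF n] n by (simp add: G2_def)
    also have "\<dots> = 4 * 4 ^ (n - 3) * 3 * (real n - 3) /
          (2 * (real n - 2) * (real n - 1) ^ (2 * n) *
            ((real n - 2) * (real n - 3) * fact (n - 4) * fact (n - 2)))"
      by (simp add: pow power2_eq_square flip: fact)
    also have "\<dots> = 6 * 4 ^ (n - 3) /
        ((real n - 1) ^ (2 * n) * (real n - 2) ^ 2 * fact (n - 4) * fact (n - 2))"
      using pos by (simp add: power2_eq_square divide_simps)
    finally show 2: "det (Q_mat (G2 n) (e2 n)) =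
        6 * 4 ^ (n - 3) /
        ((real n - 1) ^ (2 * n) * (real n - 2) ^ 2 * fact (n - 4) * fact (n - 2))" .
    define a b where "a = (real n - 1) ^ (2 * n)" and "b = (fact (n - 4) :: real)"
    have "a > 0" "b > 0" using pos by (simp_all add: a_def b_def)
    then show "det (Q_mat (G1 n) (e1 n)) / det (Q_mat (G2 n) (e2 n)) =
        1 / 12 * (real n ^ 2 / (real n - 3))"
      unfolding 1 2 fact a_def[symmetric] b_def[symmetric] using pos
      by (simp add: divide_simps) (simp add: power2_eq_square algebra_simps)
  qed
  have "filterlim (\<lambda>n. det (Q_mat (G1 n) (e1 n)) / det (Q_mat (G2 n) (e2 n)))
       at_top (inf sequentially (principal {n. even n}))"
  proof (rule filterlim_at_top_mono)
    have "filterlim (\<lambda>n. 1 / 12 * real n) at_top sequentially"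
      by (intro filterlim_tendsto_pos_mult_at_top[OF tendsto_const] filterlim_real_sequentially) simp
    then show "filterlim (\<lambda>n. 1 / 12 * real n) at_top (inf sequentially (principal {n. even n}))"
      by (rule filterlim_mono) auto
    have "1 / 12 * real n \<le> det (Q_mat (G1 n) (e1 n)) / det (Q_mat (G2 n) (e2 n))"
      if "even n" "8 \<le> n" for n
      using that by (simp add: dets(3) power2_eq_square field_simps)
    then show "\<forall>\<^sub>F n in inf sequentially (principal {n. even n}).
        1 / 12 * real n \<le> det (Q_mat (G1 n) (e1 n)) / det (Q_mat (G2 n) (e2 n))"
      unfolding eventually_inf_principal eventually_sequentially by blast
  qed
  with dets show ?thesis by blast
qed

end
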